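(* (a) A 3-arc graph is hamiltonian if and only if it is connected; that is, for every graph $G$, $X(G)$ is hamiltonian if and only if $X(G)$ is connected. (b) If $G$ is a connected graph with $\delta(G) \ge 3$, then $X^{i}(G)$ is hamiltonian for every integer $i \ge 1$.
   Context: All graphs are finite, undirected, without loops and without parallel edges. $\delta(G)$ denotes the minimum degree of $G$. An arc of a graph $G$ is an ordered pair $uv$ of adjacent vertices $u,v$ (so $uv \neq vu$, and each edge gives two arcs); $A(G)$ is the set of all arcs of $G$. A 3-arc of $G$ is a 4-tuple $(v,u,x,y)$ of vertices, possibly with $v=y$, such that both $(v,u,x)$ and $(u,x,y)$ are paths of $G$ (i.e. $v\ne x$, $u\neq y$, and $\{v,u\},\{u,x\},\{x,y\}$ are edges of $G$). The 3-arc graph $X(G)$ of $G$ is the graph with vertex set $A(G)$ in which the vertices corresponding to arcs $uv$ and $xy$ are adjacent if and only if $(v,u,x,y)$ is a 3-arc of $G$. The iterative 3-arc graphs of $G$ are defined by $X^1(G)=X(G)$ and $X^{i+1}(G)=X(X^i(G))$ for $i\ge 1$. A graph is hamiltonian if it contains a Hamilton cycle, i.e. a cycle containing every vertex. *)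

theory Defs
  imports "Graph_Theory.Graph_Theory"
begin

text \<open>
  A finite undirected graph without loops and parallel edges is a \<open>pair_graph\<close>: a finite,
  loop-free, symmetric digraph whose arcs are pairs of vertices. An edge between \<open>u\<close> and \<open>v\<close>
  is represented by the two arcs \<open>(u, v)\<close> and \<open>(v, u)\<close>, so \<open>parcs G\<close> is the arc set $A(G)$.
  The library predicate \<open>connected\<close> demands a nonempty vertex set.
\<close>

text \<open>
  By symmetry and the absence of parallel arcs, the out-degree of a vertex is its number of
  neighbours. The value is unspecified for the null graph.
\<close>

definition min_degree :: "'a pair_pre_digraph \<Rightarrow> nat" where
  "min_degree G = Min (out_degree (with_proj G) ` pverts G)"

text \<open>
  The library's \<open>cycle\<close> is a closed directed walk without repeated vertices; in a symmetric
  digraph traversing one edge back and forth qualifies. The length bound rules this out.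
\<close>

definition hamiltonian :: "'a pair_pre_digraph \<Rightarrow> bool" where
  "hamiltonian G \<longleftrightarrow>
     (\<exists>p. pre_digraph.cycle (with_proj G) p \<and> 3 \<le> length p \<and> fst ` set p = pverts G)"

definition three_arc :: "'a pair_pre_digraph \<Rightarrow> 'a \<Rightarrow> 'a \<Rightarrow> 'a \<Rightarrow> 'a \<Rightarrow> bool" where
  "three_arc G v u x y \<longleftrightarrow> vpath [v, u, x] (with_proj G) \<and> vpath [u, x, y] (with_proj G)"

definition three_arc_graph :: "'a pair_pre_digraph \<Rightarrow> ('a \<times> 'a) pair_pre_digraph" where
  "three_arc_graph G =
     \<lparr> pverts = parcs G, parcs = {((u, v), (x, y)) | u v x y. three_arc G v u x y} \<rparr>"

text \<open>
  The vertices of $X(G)$ have a different type from those of $G$. To iterate, the vertices of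
  all $X^i(G)$ are embedded into one type: \<open>Base\<close> tags the vertices of $G$, and \<open>Arc\<close> tags
  an arc of one graph as a vertex of the next. Since both constructors are injective, every
  relabelling below yields an isomorphic copy.
\<close>

datatype 'a iter_vert = Base 'a | Arc "'a iter_vert \<times> 'a iter_vert"

definition relabel :: "('a \<Rightarrow> 'b) \<Rightarrow> 'a pair_pre_digraph \<Rightarrow> 'b pair_pre_digraph" where
  "relabel f G = \<lparr> pverts = f ` pverts G, parcs = map_prod f f ` parcs G \<rparr>"

primrec iter_three_arc_graph :: "nat \<Rightarrow> 'a pair_pre_digraph \<Rightarrow> 'a iter_vert pair_pre_digraph" where
  "iter_three_arc_graph 0 G = relabel Base G"
| "iter_three_arc_graph (Suc i) G = relabel Arc (three_arc_graph (iter_three_arc_graph i G))"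

lemma (in pair_graph) three_arc_iff:
  "three_arc G v u x y \<longleftrightarrow>
     (v, u) \<in> parcs G \<and> (u, x) \<in> parcs G \<and> (x, y) \<in> parcs G \<and> v \<noteq> x \<and> u \<noteq> y"
  using in_arcsD1 in_arcsD2 pair_no_loops
  by (fastforce simp: three_arc_def vpath_def vwalk_def)

lemma pair_graph_three_arc_graph:
  assumes "pair_graph G"
  shows "pair_graph (three_arc_graph G)"
proof -
  interpret pair_graph G by fact
  have sym: "(a, b) \<in> parcs G \<Longrightarrow> (b, a) \<in> parcs G" for a b
    using pair_sym_arcs by (auto simp: symmetric_def elim: symE)
  have sub: "parcs (three_arc_graph G) \<subseteq> parcs G \<times> parcs G"
    by (auto simp: three_arc_graph_def three_arc_iff intro: sym)
  show ?thesis
  proof unfold_locales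
    show "finite (pverts (three_arc_graph G))" "finite (parcs (three_arc_graph G))"
      using pair_finite_arcs finite_subset[OF sub] by (auto simp: three_arc_graph_def)
    show "symmetric (three_arc_graph G)"
      by (auto simp: symmetric_def sym_def three_arc_graph_def three_arc_iff intro: sym)
  qed (use pair_no_loops in \<open>auto simp: three_arc_graph_def three_arc_iff intro: sym\<close>)
qed

lemma pair_graph_relabel:
  assumes "pair_graph G" "inj f"
  shows "pair_graph (relabel f G)"
proof -
  interpret pair_graph G by fact
  have sym: "(a, b) \<in> parcs G \<Longrightarrow> (b, a) \<in> parcs G" for a b
    using pair_sym_arcs by (auto simp: symmetric_def elim: symE)
  show ?thesis
  proof unfold_locales
    show "symmetric (relabel f G)"
      by (force simp: symmetric_def sym_def relabel_def dest: sym)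
  qed (use \<open>inj f\<close> in_arcsD1 in_arcsD2 pair_no_loops pair_finite_verts pair_finite_arcs in
      \<open>fastforce simp: relabel_def inj_eq\<close>)+
qed

lemma pair_graph_iter_three_arc_graph:
  "pair_graph G \<Longrightarrow> pair_graph (iter_three_arc_graph i G)"
  by (induction i) (auto intro!: pair_graph_relabel pair_graph_three_arc_graph simp: inj_def)

lemma three_arc_graph_relabel:
  assumes "pair_graph G" "inj f"
  shows "three_arc_graph (relabel f G) = relabel (map_prod f f) (three_arc_graph G)"
proof -
  interpret G: pair_graph G by fact
  interpret H: pair_graph "relabel f G" using assms by (rule pair_graph_relabel)
  show ?thesis
    unfolding three_arc_graph_def relabel_def[of "map_prod f f"]
    by (simp add: H.three_arc_iff G.three_arc_iff)
       (use \<open>inj f\<close> in \<open>force simp: relabel_def inj_eq image_iff\<close>)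
qed

lemma iter_three_arc_graph_1:
  assumes "pair_graph G"
  shows "iter_three_arc_graph 1 G = relabel (Arc \<circ> map_prod Base Base) (three_arc_graph G)"
proof -
  have "iter_three_arc_graph 1 G = relabel Arc (three_arc_graph (relabel Base G))"
    by simp
  also have "\<dots> = relabel Arc (relabel (map_prod Base Base) (three_arc_graph G))"
    using assms by (simp add: three_arc_graph_relabel inj_def)
  finally show ?thesis
    by (simp add: relabel_def image_comp map_prod.comp)
qed

end

theory Submission
  imports Defs "HOL-Combinatorics.Transposition"
begin

text \<open>
  Two arcs $uv$ and $xy$ that are adjacent in $X(G)$ start at adjacent vertices. So a Hamilton
  cycle of $X(G)$ is a closed walk of $G$ that visits every vertex $u$ exactly $\deg u$ times,
  together with a name for each visit: a neighbour of $u$ that the walk neither comes from nor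
  goes to in that visit, every neighbour naming exactly one visit to $u$. The proof finds such
  walks among those that use each edge exactly twice.

  Double every edge. Each copy has two half-edges, and the half-edge \<open>(u, x, b)\<close> sits at $u$ and
  leads to $x$ in copy \<open>b\<close>. A \<^emph>\<open>labelling\<close> at $u$ maps the half-edges at $u$ to the
  neighbours of $u$, takes each neighbour twice, and never maps a half-edge to the neighbour it
  leads to. The two half-edges with the same label form a visit to $u$ with that name.
  Labellings at all vertices therefore decompose the doubled graph into closed walks, and if there
  is only one walk, then it is a Hamilton cycle of $X(G)$
  (\<open>hamiltonian_three_arc_graph_if_all_joined\<close>). Here a walk is an orbit of the group generated
  by two involutions without fixed points: changing the end of an edge, and changing between the
  two half-edges of a visit (\<open>alternating_cycle\<close>).

  The key point is that the labelling at a vertex $w$ of degree at least three can be replaced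
  by one that merges all closed walks through $w$ into a single one (\<open>join_at_vertex\<close>). Cutting
  the walks at $w$ leaves paths with both ends at $w$, so the paths split the half-edges at $w$ into
  classes of even size, and by \<open>joining_labelling\<close> there is always a labelling that links all
  these classes. Nothing that was joined before gets separated, hence the vertices of degree at
  least three can be treated one after the other.

  A vertex of degree two has only one labelling: the walk turns back at each visit. At every other
  vertex all walks are joined now. This matches the adjacency of $X(G)$ exactly: the half-edges
  at $u$ that may be used in a visit named $v$ lie on one walk, and if the arcs $uv$ and $xy$ are
  adjacent, the edge $ux$ may be used both in the visit to $u$ named $v$ and in the visit to $x$
  named $y$. So connectedness of $X(G)$ forces a single walk
  (\<open>hamiltonian_three_arc_graph_if_connected\<close>). The converse is clear. Finally $X(G)$ is
  connected with minimum degree at least four if $G$ is connected with minimum degree at least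
  three, which yields the statement on iterated 3-arc graphs by induction.
\<close>

section \<open>Even classes and two-to-one maps\<close>

lemma equivclp_least:
  assumes "equivclp r x y" "\<And>a b. r a b \<Longrightarrow> equivclp s a b"
  shows "equivclp s x y"
  using assms(1)
proof induction
  case (step y z)
  then have "equivclp s y z" using assms(2) equivclp_sym by metis
  with step.IH show ?case by (rule equivclp_trans)
qed simp

lemma even_card_if_fibres_doubletons:
  assumes "finite S" "\<And>x. x \<in> S \<Longrightarrow> card {y \<in> S. g y = g x} = 2"
  shows "even (card S)"
proof -
  have "card S = (\<Sum>y\<in>g ` S. card {x \<in> S. g x = y})"
    using sum.image_gen[OF assms(1), of "\<lambda>_. 1::nat" g] by simp
  also have "\<dots> = (\<Sum>y\<in>g ` S. 2)"
    using assms(2) by (intro sum.cong) auto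
  finally show ?thesis by simp
qed

lemma even_card_if_involution:
  assumes "finite S" "\<And>x. x \<in> S \<Longrightarrow> f x \<in> S \<and> f x \<noteq> x \<and> f (f x) = x"
  shows "even (card S)"
proof (rule even_card_if_fibres_doubletons[OF assms(1)])
  fix x assume "x \<in> S"
  then have "{y \<in> S. {y, f y} = {x, f x}} = {x, f x}"
    using assms(2) by (auto simp: doubleton_eq_iff)
  then show "card {y \<in> S. {y, f y} = {x, f x}} = 2"
    using assms(2)[OF \<open>x \<in> S\<close>] by (metis card_2_iff)
qed

lemma doubleton_other_element:
  assumes "card A = 2" "x \<in> A"
  shows "\<exists>y. y \<noteq> x \<and> A = {x, y}"
proof -
  have "card (A - {x}) = 1" using assms by simp
  then obtain y where "A - {x} = {y}" by (auto simp: card_1_singleton_iff)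
  with assms(2) show ?thesis by (intro exI[of _ y]) auto
qed

text \<open>
  Splitting off one equivalent pair at a time keeps all classes even, so the set can be listed in
  consecutive equivalent pairs. This replaces the paths that remain when closed walks are cut:
  only the pairing of their ends matters.
\<close>

lemma even_classes_pairing:
  assumes "finite S" "equivp E" "\<And>x. x \<in> S \<Longrightarrow> even (card {y \<in> S. E x y})"
  obtains zs where "distinct zs" "set zs = S"
    "\<And>i. 2 * i + 1 < length zs \<Longrightarrow> E (zs ! (2 * i)) (zs ! (2 * i + 1))"
proof -
  have "\<exists>zs. distinct zs \<and> set zs = S \<and>
          (\<forall>i. 2 * i + 1 < length zs \<longrightarrow> E (zs ! (2 * i)) (zs ! (2 * i + 1)))"
    using assms(1,3)
  proof (induction S rule: finite_psubset_induct)
    case (psubset S)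
    show ?case
    proof (cases "S = {}")
      case False
      then obtain a where a: "a \<in> S" by blast
      have refl: "E a a" using assms(2) by (simp add: equivp_reflp)
      obtain b where b: "b \<in> S" "b \<noteq> a" "E a b"
      proof (rule ccontr)
        assume "\<not> thesis"
        with that refl a have "{y \<in> S. E a y} = {a}" by blast
        with psubset.prems[OF a] show False by simp
      qed
      let ?T = "S - {a, b}"
      have "even (card {y \<in> ?T. E x y})" if x: "x \<in> ?T" for x
      proof (cases "E x a")
        case True
        then have "E x b" using b assms(2) by (meson equivp_transp)
        with True a b have eq: "{y \<in> S. E x y} = insert a (insert b {y \<in> ?T. E x y})" by auto
        have "finite {y \<in> ?T. E x y}" using psubset.hyps by simp
        with b(2) have "card {y \<in> S. E x y} = Suc (Suc (card {y \<in> ?T. E x y}))"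
          unfolding eq by simp
        with psubset.prems[of x] x show ?thesis by simp
      next
        case False
        then have "\<not> E x b" using b assms(2) by (meson equivp_symp equivp_transp)
        with False have "{y \<in> S. E x y} = {y \<in> ?T. E x y}" by auto
        with psubset.prems[of x] x show ?thesis by simp
      qed
      then obtain zs where zs: "distinct zs" "set zs = ?T"
        "\<And>i. 2 * i + 1 < length zs \<Longrightarrow> E (zs ! (2 * i)) (zs ! (2 * i + 1))"
        using psubset.IH[of ?T] a by blast
      have "E ((a # b # zs) ! (2 * i)) ((a # b # zs) ! (2 * i + 1))"
        if "2 * i + 1 < length (a # b # zs)" for i
        using that zs(3) b(3) by (cases i) auto
      moreover have "distinct (a # b # zs)" "set (a # b # zs) = S"
        using zs a b by auto
      ultimately show ?thesis by blast
    qed simp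
  qed
  then show thesis using that by blast
qed

text \<open>
  List \<open>S\<close> as $z_0, z_1, \dots$ so that $z_{2i}$ and $z_{2i+1}$ are equivalent, and let the map
  identify $z_{2i+1}$ with $z_{2i+2}$ cyclically. Then the equivalence and the map
  together link the whole list.
\<close>

lemma connecting_two_to_one_map:
  assumes "finite N" "N \<noteq> {}" "finite S" "card S = 2 * card N" "equivp E"
    and even: "\<And>x. x \<in> S \<Longrightarrow> even (card {y \<in> S. E x y})"
  obtains l where "\<And>x. x \<in> S \<Longrightarrow> l x \<in> N" "\<And>v. v \<in> N \<Longrightarrow> card {x \<in> S. l x = v} = 2"
    "\<And>x y. x \<in> S \<Longrightarrow> y \<in> S \<Longrightarrow> equivclp (\<lambda>a b. a \<in> S \<and> b \<in> S \<and> (E a b \<or> l a = l b)) x y"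
proof -
  let ?d = "card N"
  have d: "?d > 0" using assms by (simp add: card_gt_0_iff)
  obtain zs where zs: "distinct zs" "set zs = S"
    "\<And>i. 2 * i + 1 < length zs \<Longrightarrow> E (zs ! (2 * i)) (zs ! (2 * i + 1))"
    using even_classes_pairing[OF assms(3,5) even] by blast
  have len: "length zs = 2 * ?d" using zs assms by (metis distinct_card)
  let ?z = "\<lambda>j. zs ! j"
  have bz: "bij_betw ?z {..<2 * ?d} S" using zs len bij_betw_nth by metis
  obtain v where v: "bij_betw v {..<?d} N"
    using assms(1) ex_bij_betw_nat_finite lessThan_atLeast0 by metis
  \<comment> \<open>the last element wraps around to share its value with the first one\<close>
  define ix where "ix j = Suc j div 2 mod ?d" for j
  define l where "l = v \<circ> ix \<circ> the_inv_into {..<2 * ?d} ?z"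
  have lz: "l (?z j) = v (ix j)" if "j < 2 * ?d" for j
    using that bz by (simp add: l_def bij_betw_def the_inv_into_f_f)
  have ix_lt: "ix j < ?d" for j using d by (simp add: ix_def)
  have S_iff: "x \<in> S \<longleftrightarrow> (\<exists>j < 2 * ?d. x = ?z j)" for x
    using bz by (auto simp: bij_betw_def)
  have fib: "card {j \<in> {..<2 * ?d}. ix j = i} = 2" if i: "i < ?d" for i
  proof (cases i)
    case 0
    have "ix j = 0 \<longleftrightarrow> j = 0 \<or> j = 2 * ?d - 1" if j: "j < 2 * ?d" for j
    proof (cases "j = 2 * ?d - 1")
      case True
      with d show ?thesis by (simp add: ix_def)
    next
      case False
      with j have "Suc j div 2 < ?d" by linarith
      then have "ix j = Suc j div 2" by (simp add: ix_def)
      with False show ?thesis by (simp; linarith)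
    qed
    then have "{j \<in> {..<2 * ?d}. ix j = i} = {0, 2 * ?d - 1}"
      using 0 d by auto
    then show ?thesis using d by simp
  next
    case (Suc i')
    have "ix j = i \<longleftrightarrow> j = 2 * i - 1 \<or> j = 2 * i" if j: "j < 2 * ?d" for j
    proof (cases "j = 2 * ?d - 1")
      case True
      with d Suc i show ?thesis by (simp add: ix_def; linarith)
    next
      case False
      with j have "Suc j div 2 < ?d" by linarith
      then have "ix j = Suc j div 2" by (simp add: ix_def)
      with Suc show ?thesis by (simp; linarith)
    qed
    then have "{j \<in> {..<2 * ?d}. ix j = i} = {2 * i - 1, 2 * i}"
      using Suc i by auto
    then show ?thesis using Suc by simp
  qed
  show thesis
  proof (rule that)
    show "l x \<in> N" if "x \<in> S" for x
      using that ix_lt v by (auto simp: S_iff lz bij_betw_def)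
    show "card {x \<in> S. l x = w} = 2" if w: "w \<in> N" for w
    proof -
      obtain i where i: "i < ?d" "w = v i" using w v by (auto simp: bij_betw_def)
      have "v (ix j) = v i \<longleftrightarrow> ix j = i" for j
        using v i ix_lt[of j] by (auto simp: bij_betw_def inj_on_def)
      then have "{x \<in> S. l x = w} = ?z ` {j \<in> {..<2 * ?d}. ix j = i}"
        using i by (force simp: S_iff lz)
      moreover have "inj_on ?z {j \<in> {..<2 * ?d}. ix j = i}"
        using bz by (auto simp: bij_betw_def inj_on_def)
      ultimately show ?thesis using fib[OF i(1)] by (simp add: card_image)
    qed
    let ?R = "equivclp (\<lambda>a b. a \<in> S \<and> b \<in> S \<and> (E a b \<or> l a = l b))"
    have "?R (?z 0) (?z j)" if "j < 2 * ?d" for j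
      using that
    proof (induction j)
      case (Suc j)
      have "E (?z j) (?z (Suc j)) \<or> l (?z j) = l (?z (Suc j))"
      proof (cases "even j")
        case True
        then show ?thesis using zs(3)[of "j div 2"] Suc.prems len by simp
      next
        case False
        then have "Suc j div 2 = Suc (Suc j) div 2" by presburger
        then show ?thesis using Suc.prems by (simp add: lz ix_def)
      qed
      moreover have "?z j \<in> S" "?z (Suc j) \<in> S" using Suc.prems S_iff Suc_lessD by blast+
      ultimately have "?R (?z j) (?z (Suc j))" by blast
      with Suc show ?case by (meson Suc_lessD equivclp_trans)
    qed simp
    then have "?R (?z 0) x" if "x \<in> S" for x
      using that bz by (auto simp: bij_betw_def)
    then show "?R x y" if "x \<in> S" "y \<in> S" for x y
      using that by (meson equivclp_sym equivclp_trans)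
  qed
qed

section \<open>Labellings of one neighbourhood\<close>

text \<open>
  A pair \<open>(x, b)\<close> stands for the half-edge to the neighbour \<open>x\<close> in copy \<open>b\<close> of the edge, and \<open>N\<close>
  for the neighbourhood of the vertex at which it sits. The two half-edges with label \<open>v\<close>
  are the ones through which the closed walk passes in its visit named \<open>v\<close>.
\<close>

definition labelling :: "'a set \<Rightarrow> ('a \<times> bool \<Rightarrow> 'a) \<Rightarrow> bool" where
  "labelling N l \<longleftrightarrow>
     (\<forall>k\<in>N \<times> UNIV. l k \<in> N \<and> l k \<noteq> fst k) \<and>
     (\<forall>v\<in>N. card {k \<in> N \<times> UNIV. l k = v} = 2)"

text \<open>
  A bijection with fewest conflicts has none. If the value \<open>v\<close> is in conflict, exchange it with
  another value \<open>w\<close>: at most two choices of \<open>w\<close> leave a conflict at \<open>v\<close>, at most two create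
  one at \<open>w\<close>, and \<open>v\<close> itself is among both. So only three of the at least four values are
  excluded.
\<close>

lemma relabel_avoiding_self:
  assumes "finite N" "4 \<le> card N"
    and l: "\<And>k. k \<in> N \<times> UNIV \<Longrightarrow> l k \<in> N" "\<And>v. v \<in> N \<Longrightarrow> card {k \<in> N \<times> UNIV. l k = v} = 2"
  obtains \<pi> where "bij_betw \<pi> N N" "\<And>k. k \<in> N \<times> (UNIV :: bool set) \<Longrightarrow> \<pi> (l k) \<noteq> fst k"
proof -
  define hit where "hit v = fst ` {k \<in> N \<times> (UNIV :: bool set). l k = v}" for v
  define bad where "bad \<pi> = {v \<in> N. \<pi> v \<in> hit v}" for \<pi>
  have fin: "finite (bad \<pi>)" for \<pi> using assms(1) by (simp add: bad_def)
  obtain \<pi> where \<pi>: "bij_betw \<pi> N N" "\<And>\<rho>. bij_betw \<rho> N N \<Longrightarrow> card (bad \<pi>) \<le> card (bad \<rho>)"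
    using ex_has_least_nat[of "\<lambda>\<pi>. bij_betw \<pi> N N" id "\<lambda>\<pi>. card (bad \<pi>)"] by auto
  have "bad \<pi> = {}"
  proof (rule ccontr)
    assume "bad \<pi> \<noteq> {}"
    then obtain v where v: "v \<in> N" "\<pi> v \<in> hit v" by (auto simp: bad_def)
    define B where "B = {w \<in> N. \<pi> w \<in> hit v}"
    define C where "C = {w \<in> N. \<pi> v \<in> hit w}"
    have finB: "finite B" "finite C" using assms(1) by (auto simp: B_def C_def)
    have "card (hit v) \<le> card {k \<in> N \<times> (UNIV :: bool set). l k = v}"
      unfolding hit_def using assms(1) by (intro card_image_le) auto
    then have "card (hit v) \<le> 2" using l(2)[OF v(1)] by simp
    moreover have "card B \<le> card (hit v)"
    proof (rule card_inj_on_le[of \<pi>])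
      show "inj_on \<pi> B" using \<pi>(1) by (auto simp: B_def bij_betw_def inj_on_def)
      show "\<pi> ` B \<subseteq> hit v" by (auto simp: B_def)
      show "finite (hit v)" using assms(1) by (simp add: hit_def)
    qed
    ultimately have B2: "card B \<le> 2" by simp
    have "C \<subseteq> {l (\<pi> v, True), l (\<pi> v, False)}"
    proof
      fix w assume "w \<in> C"
      then obtain b where "l (\<pi> v, b) = w" by (auto simp: C_def hit_def)
      then show "w \<in> {l (\<pi> v, True), l (\<pi> v, False)}" by (cases b) auto
    qed
    then have "card C \<le> card {l (\<pi> v, True), l (\<pi> v, False)}" by (intro card_mono) auto
    also have "\<dots> \<le> 2" by (simp add: card_insert_if)
    finally have C2: "card C \<le> 2" .
    have vBC: "v \<in> B" "v \<in> C" using v by (auto simp: B_def C_def)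
    have "card (B \<union> C) \<le> card B + card C - 1"
    proof -
      have "card (B \<inter> C) \<ge> 1" using vBC finB 
        by (auto simp: Suc_le_eq card_gt_0_iff)
      then show ?thesis using card_Un_Int[OF finB] by simp
    qed
    with B2 C2 assms(2) have "card (B \<union> C) < card N" by simp
    moreover have "B \<union> C \<subseteq> N" by (auto simp: B_def C_def)
    ultimately have "B \<union> C \<subset> N" by auto
    then obtain w where w: "w \<in> N" "w \<notin> B" "w \<notin> C" by blast
    with vBC have "w \<noteq> v" by blast
    define \<rho> where "\<rho> = \<pi> \<circ> transpose v w"
    have "bij_betw \<rho> N N"
      unfolding \<rho>_def using v(1) w(1) \<pi>(1)
      by (intro bij_betw_trans[of _ N N]) (auto simp: bij_betw_def inj_on_def transpose_def)
    moreover have "bad \<rho> \<subseteq> bad \<pi> - {v}"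
      using w \<open>w \<noteq> v\<close> by (auto simp: bad_def \<rho>_def B_def C_def transpose_def split: if_splits)
    then have "card (bad \<rho>) < card (bad \<pi>)"
      using v fin by (intro psubset_card_mono) (auto simp: bad_def)
    ultimately show False using \<pi>(2) by (meson not_le)
  qed
  show thesis
  proof (rule that[OF \<pi>(1)])
    fix k assume k: "k \<in> N \<times> (UNIV :: bool set)"
    then have "fst k \<in> hit (l k)" by (auto simp: hit_def)
    moreover have "\<pi> (l k) \<notin> hit (l k)" using \<open>bad \<pi> = {}\<close> l(1)[OF k] by (auto simp: bad_def)
    ultimately show "\<pi> (l k) \<noteq> fst k" by metis
  qed
qed

text \<open>
  For three neighbours not every two-to-one map can be made to avoid its own ends by renaming its
  values: a walk that goes twice from $a$ to $b$ and once turns back at $c$ would need the name $c$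
  twice. The pairs that can be named are either three turns, or one passage between any two of the
  three neighbours. If no neighbour has its two copies equivalent, three turns suffice,
  because each neighbour is linked to another one and on three points this makes everything
  linked. Otherwise take the copies of $a$ to be equivalent and use three passages, where the
  copy of $c$ used in each of them can be chosen so that the passage between $b$ and $c$ is linked
  to the rest.
\<close>

lemma joining_labelling_3:
  assumes N: "finite N" "card N = 3" and E: "equivp E"
    and nontriv: "\<And>k. k \<in> N \<times> UNIV \<Longrightarrow> \<exists>k'\<in>N \<times> UNIV. k' \<noteq> k \<and> E k k'"
  obtains l where "labelling N l"
    "\<And>k k'. k \<in> N \<times> UNIV \<Longrightarrow> k' \<in> N \<times> UNIV \<Longrightarrow>
       equivclp (\<lambda>a b. a \<in> N \<times> UNIV \<and> b \<in> N \<times> UNIV \<and> (E a b \<or> l a = l b)) k k'"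
proof -
  let ?S = "N \<times> (UNIV :: bool set)"
  let ?R = "\<lambda>l. equivclp (\<lambda>a b. a \<in> ?S \<and> b \<in> ?S \<and> (E a b \<or> l a = l b))"
  have R_E: "?R l x y" if "x \<in> ?S" "y \<in> ?S" "E x y" for l :: "'a \<times> bool \<Rightarrow> 'a" and x y
    using that by (intro r_into_equivclp) auto
  have R_l: "?R l x y" if "x \<in> ?S" "y \<in> ?S" "l x = l y" for l :: "'a \<times> bool \<Rightarrow> 'a" and x y
    using that by (intro r_into_equivclp) auto
  show thesis
  proof (cases "\<exists>a\<in>N. E (a, False) (a, True)")
    case True
    then obtain a where a: "a \<in> N" "E (a, False) (a, True)" by blast
    then have "card (N - {a}) = 2" using N by simp
    then obtain b c where bc: "N - {a} = {b, c}" "b \<noteq> c" by (auto simp: card_2_iff)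
    with a have N_eq: "N = {a, b, c}" and neq: "a \<noteq> b" "a \<noteq> c" by auto
    \<comment> \<open>\<open>(c, z)\<close> is paired with \<open>(a, True)\<close> and the other copy of \<open>c\<close> with \<open>(b, True)\<close>; if
      \<open>(b, True)\<close> and \<open>(c, True)\<close> are equivalent, they have to go to different pairs\<close>
    define z where "z = E (b, True) (c, True)"
    define l where "l k = (if k = (a, False) \<or> k = (b, False) then c
                           else if k = (a, True) \<or> k = (c, z) then b else a)" for k
    have S: "?S = {(a, False), (a, True), (b, False), (b, True), (c, z), (c, \<not> z)}"
      unfolding N_eq by (cases z) (auto simp: UNIV_bool)
    have fib: "{k \<in> ?S. l k = c} = {(a, False), (b, False)}"
      "{k \<in> ?S. l k = b} = {(a, True), (c, z)}" "{k \<in> ?S. l k = a} = {(b, True), (c, \<not> z)}"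
      unfolding S using neq bc by (auto simp: l_def)
    have "labelling N l"
      unfolding labelling_def
    proof
      show "\<forall>k\<in>?S. l k \<in> N \<and> l k \<noteq> fst k"
        unfolding S using neq bc by (auto simp: l_def N_eq)
      show "\<forall>v\<in>N. card {k \<in> ?S. l k = v} = 2"
        using neq bc unfolding N_eq by (auto simp: fib[unfolded N_eq])
    qed
    have in_S: "(a, x) \<in> ?S" "(b, x) \<in> ?S" "(c, x) \<in> ?S" for x by (auto simp: N_eq)
    have 1: "?R l (a, False) (a, True)" using a in_S by (intro R_E)
    have 2: "?R l (a, False) (b, False)" using in_S by (intro R_l) (auto simp: l_def)
    have "?R l (a, True) (c, z)" using in_S neq by (intro R_l) (auto simp: l_def)
    with 1 have 3: "?R l (a, False) (c, z)" by (rule equivclp_trans)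
    have 4: "?R l (b, True) (c, \<not> z)" using in_S neq bc by (intro R_l) (auto simp: l_def)
    have 5: "?R l (a, False) (b, True)"
    proof (cases z)
      case True
      then have "?R l (c, z) (b, True)" using E in_S by (intro R_E) (auto simp: z_def dest: equivp_symp)
      with 3 show ?thesis by (rule equivclp_trans)
    next
      case False
      obtain k where k: "k \<in> ?S" "k \<noteq> (b, True)" "E (b, True) k" using nontriv in_S by blast
      with False have "k \<noteq> (c, \<not> z)" by (auto simp: z_def)
      with k 1 2 3 have "?R l (a, False) k" by (auto simp: S)
      moreover have "?R l k (b, True)" using k E in_S by (intro R_E) (auto dest: equivp_symp)
      ultimately show ?thesis by (rule equivclp_trans)
    qed
    with 4 have "?R l (a, False) (c, \<not> z)" by (meson equivclp_trans)
    with 1 2 3 5 have all: "?R l (a, False) k" if "k \<in> ?S" for k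
      using that unfolding S by auto
    show thesis
    proof (rule that[OF \<open>labelling N l\<close>])
      show "?R l k k'" if "k \<in> ?S" "k' \<in> ?S" for k k'
        using all[OF that(1)] all[OF that(2)] by (meson equivclp_sym equivclp_trans)
    qed
  next
    case False
    obtain a b c where N_eq: "N = {a, b, c}" and neq: "a \<noteq> b" "a \<noteq> c" "b \<noteq> c"
      using N by (auto simp: card_3_iff)
    define l where "l k = (if fst k = a then b else if fst k = b then c else a)" for k :: "'a \<times> bool"
    have S: "?S = {(a, False), (a, True), (b, False), (b, True), (c, False), (c, True)}"
      unfolding N_eq by (auto simp: UNIV_bool)
    have fib: "{k \<in> ?S. l k = c} = {(b, False), (b, True)}"
      "{k \<in> ?S. l k = b} = {(a, False), (a, True)}" "{k \<in> ?S. l k = a} = {(c, False), (c, True)}"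
      unfolding S using neq by (auto simp: l_def)
    have "labelling N l"
      unfolding labelling_def
    proof
      show "\<forall>k\<in>?S. l k \<in> N \<and> l k \<noteq> fst k"
        unfolding S using neq by (auto simp: l_def N_eq)
      show "\<forall>v\<in>N. card {k \<in> ?S. l k = v} = 2"
        using neq unfolding N_eq by (auto simp: fib[unfolded N_eq])
    qed
    have fst: "?R l (x, p) (x, q)" if "x \<in> N" for x p q
      using that by (intro R_l) (auto simp: l_def)
    have step: "\<exists>y\<in>N. y \<noteq> x \<and> (\<forall>p q. ?R l (x, p) (y, q))" if x: "x \<in> N" for x
    proof -
      obtain y q where y: "y \<in> N" "(y, q) \<noteq> (x, False)" "E (x, False) (y, q)"
        using nontriv[of "(x, False)"] x by auto
      have "y \<noteq> x"
      proof
        assume "y = x"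
        with y(2) have "q" by auto
        with y \<open>y = x\<close> False x show False by simp
      qed
      moreover have "?R l (x, False) (y, q)" using x y by (intro R_E) auto
      then have "?R l (x, p') (y, q')" for p' q'
        using fst[OF x, of p' False] fst[OF y(1), of q q'] by (meson equivclp_trans)
      ultimately show ?thesis using y(1) by blast
    qed
    define J where "J x y \<longleftrightarrow> (\<forall>p q. ?R l (x, p) (y, q))" for x y
    have J_sym: "J y x" if "J x y" for x y using that unfolding J_def by (meson equivclp_sym)
    have J_trans: "J x w" if "J x y" "J y w" for x y w
      using that unfolding J_def by (meson equivclp_trans)
    have J_refl: "J x x" if "x \<in> N" for x using fst[OF that] by (simp add: J_def)
    have nb: "\<exists>y\<in>N. y \<noteq> x \<and> J x y" if "x \<in> N" for x
      using step[OF that] by (simp add: J_def)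
    have "J a b \<or> J a c" "J b a \<or> J b c" "J c a \<or> J c b"
      using nb[of a] nb[of b] nb[of c] unfolding N_eq by blast+
    then have "J a b" "J a c" "J b c" using J_sym J_trans by blast+
    then have J_all: "J x y" if "x \<in> N" "y \<in> N" for x y
      using that J_refl J_sym unfolding N_eq by blast
    show thesis
    proof (rule that[OF \<open>labelling N l\<close>])
      show "?R l k k'" if "k \<in> ?S" "k' \<in> ?S" for k k'
        using that J_all unfolding J_def by (cases k; cases k') blast
    qed
  qed
qed

text \<open>
  With at least four neighbours every two-to-one map is a labelling after renaming its values, so
  linking and avoiding can be arranged one after the other.
\<close>

lemma joining_labelling:
  assumes N: "finite N" "3 \<le> card N" and E: "equivp E"
    and even: "\<And>k. k \<in> N \<times> UNIV \<Longrightarrow> even (card {k' \<in> N \<times> UNIV. E k k'})"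
  obtains l where "labelling N l"
    "\<And>k k'. k \<in> N \<times> UNIV \<Longrightarrow> k' \<in> N \<times> UNIV \<Longrightarrow>
       equivclp (\<lambda>a b. a \<in> N \<times> UNIV \<and> b \<in> N \<times> UNIV \<and> (E a b \<or> l a = l b)) k k'"
proof (cases "card N = 3")
  case True
  have "\<exists>k'\<in>N \<times> UNIV. k' \<noteq> k \<and> E k k'" if k: "k \<in> N \<times> UNIV" for k
  proof (rule ccontr)
    assume "\<not> ?thesis"
    with k E have "{k' \<in> N \<times> UNIV. E k k'} = {k}" by (auto simp: equivp_reflp)
    with even[OF k] show False by simp
  qed
  with joining_labelling_3[OF N(1) True E] that show thesis by blast
next
  case False
  let ?S = "N \<times> (UNIV :: bool set)"
  have S: "finite ?S" "card ?S = 2 * card N" and ne: "N \<noteq> {}"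
    using N by (auto simp: card_cartesian_product)
  show thesis
  proof (rule connecting_two_to_one_map[OF N(1) ne S E even])
    fix m :: "'a \<times> bool \<Rightarrow> 'a"
    assume m: "\<And>k. k \<in> ?S \<Longrightarrow> m k \<in> N" "\<And>v. v \<in> N \<Longrightarrow> card {k \<in> ?S. m k = v} = 2"
      "\<And>k k'. k \<in> ?S \<Longrightarrow> k' \<in> ?S \<Longrightarrow> equivclp (\<lambda>a b. a \<in> ?S \<and> b \<in> ?S \<and> (E a b \<or> m a = m b)) k k'"
    obtain \<pi> where \<pi>: "bij_betw \<pi> N N" "\<And>k. k \<in> ?S \<Longrightarrow> \<pi> (m k) \<noteq> fst k"
      by (rule relabel_avoiding_self[of N m]) (use N False m in auto)
    have "labelling N (\<pi> \<circ> m)"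
      unfolding labelling_def
    proof (intro conjI ballI)
      fix w assume "w \<in> N"
      then obtain v where v: "v \<in> N" "w = \<pi> v" using \<pi>(1) by (auto simp: bij_betw_def)
      then have "{k \<in> ?S. (\<pi> \<circ> m) k = w} = {k \<in> ?S. m k = v}"
        using \<pi>(1) m(1) by (auto simp: bij_betw_def inj_on_def)
      with m(2)[OF v(1)] show "card {k \<in> ?S. (\<pi> \<circ> m) k = w} = 2" by simp
    qed (use \<pi> m(1) in \<open>auto simp: bij_betw_def\<close>)
    then show thesis
    proof (rule that)
      show "equivclp (\<lambda>a b. a \<in> ?S \<and> b \<in> ?S \<and> (E a b \<or> (\<pi> \<circ> m) a = (\<pi> \<circ> m) b)) k k'"
        if "k \<in> ?S" "k' \<in> ?S" for k k'
        by (rule equivclp_least[OF m(3)[OF that]]) auto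
    qed
  qed
qed

text \<open>
  A cyclic shift of the neighbours names all turns.
\<close>

lemma ex_labelling:
  assumes "finite N" "2 \<le> card N"
  obtains l where "labelling N l"
proof -
  let ?d = "card N"
  obtain v where v: "bij_betw v {..<?d} N"
    using assms(1) ex_bij_betw_nat_finite lessThan_atLeast0 by metis
  define s where "s i = Suc i mod ?d" for i
  have "inj_on s {..<?d}"
  proof (rule inj_onI)
    fix i j assume "i \<in> {..<?d}" "j \<in> {..<?d}" "s i = s j"
    then show "i = j"
      unfolding s_def by (cases "Suc i = ?d"; cases "Suc j = ?d") auto
  qed
  moreover have "s ` {..<?d} \<subseteq> {..<?d}" using assms by (auto simp: s_def)
  ultimately have s: "bij_betw s {..<?d} {..<?d}"
    by (simp add: bij_betw_def endo_inj_surj)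
  define \<pi> where "\<pi> = v \<circ> s \<circ> the_inv_into {..<?d} v"
  have \<pi>: "bij_betw \<pi> N N"
    unfolding \<pi>_def
    by (rule bij_betw_trans[OF bij_betw_the_inv_into[OF v] bij_betw_trans[OF s v]])
  have \<pi>_ne: "\<pi> x \<noteq> x" if x: "x \<in> N" for x
  proof -
    obtain i where i: "i < ?d" "x = v i" using x v by (auto simp: bij_betw_def)
    then have "the_inv_into {..<?d} v x = i"
      using v by (auto simp: bij_betw_def the_inv_into_f_f)
    then have "\<pi> x = v (s i)" by (simp add: \<pi>_def)
    moreover have "s i \<noteq> i" "s i < ?d"
      using i assms by (auto simp: s_def mod_Suc)
    ultimately show ?thesis using i v by (auto simp: bij_betw_def inj_on_def)
  qed
  have "labelling N (\<pi> \<circ> fst)"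
    unfolding labelling_def
  proof (intro conjI ballI)
    fix w assume "w \<in> N"
    then obtain x where x: "x \<in> N" "w = \<pi> x" using \<pi> by (auto simp: bij_betw_def)
    then have "{k \<in> N \<times> UNIV. (\<pi> \<circ> fst) k = w} = {(x, False), (x, True)}"
      using \<pi> by (auto simp: bij_betw_def inj_on_def)
    then show "card {k \<in> N \<times> (UNIV :: bool set). (\<pi> \<circ> fst) k = w} = 2" by simp
  qed (use \<pi> \<pi>_ne in \<open>auto simp: bij_betw_def\<close>)
  then show thesis by (rule that)
qed

section \<open>The cycle traced by two involutions\<close>

text \<open>
  Two involutions generate a dihedral group, and \<open>\<psi>\<close> conjugates \<open>f = \<phi> \<circ> \<psi>\<close> to its inverse. If
  \<open>\<psi>\<close> mapped an orbit of \<open>f\<close> into itself as a reflection, then \<open>\<psi>\<close> or \<open>\<phi>\<close> would fix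
  a point of it. So each orbit of the group is the disjoint union of one orbit of \<open>f\<close> and its image
  under \<open>\<psi>\<close>, and as the group acts transitively, running through a single orbit of \<open>f\<close> meets each
  pair \<open>{x, \<psi> x}\<close> exactly once.
\<close>

lemma alternating_cycle:
  fixes \<phi> \<psi> :: "'h \<Rightarrow> 'h"
  assumes fin: "finite D" and "h0 \<in> D"
    and \<phi>: "\<And>x. x \<in> D \<Longrightarrow> \<phi> x \<in> D \<and> \<phi> x \<noteq> x \<and> \<phi> (\<phi> x) = x"
    and \<psi>: "\<And>x. x \<in> D \<Longrightarrow> \<psi> x \<in> D \<and> \<psi> x \<noteq> x \<and> \<psi> (\<psi> x) = x"
    and conn: "\<And>x. x \<in> D \<Longrightarrow> equivclp (\<lambda>a b. a \<in> D \<and> (b = \<phi> a \<or> b = \<psi> a)) h0 x"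
  obtains h :: "nat \<Rightarrow> 'h" and n where "0 < n" "h n = h 0" "\<And>i. h (Suc i) = \<phi> (\<psi> (h i))"
    "\<And>i. h i \<in> D" "\<And>i j. i < n \<Longrightarrow> j < n \<Longrightarrow> h j = h i \<or> h j = \<psi> (h i) \<Longrightarrow> i = j"
    "\<And>x. x \<in> D \<Longrightarrow> \<exists>i<n. x = h i \<or> x = \<psi> (h i)"
proof -
  define f where "f = \<phi> \<circ> \<psi>"
  have f_D: "f x \<in> D" if "x \<in> D" for x using that \<phi> \<psi> by (simp add: f_def)
  have pow_D: "(f ^^ k) x \<in> D" if "x \<in> D" for k x using that f_D by (induction k) auto
  have f_inj: "x = y" if "f x = f y" "x \<in> D" "y \<in> D" for x y
    using that \<phi> \<psi> unfolding f_def comp_apply by metis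
  have pow_inj: "x = y" if "(f ^^ k) x = (f ^^ k) y" "x \<in> D" "y \<in> D" for k x y
    using that f_inj pow_D by (induction k) auto
  have flip: "(f ^^ k) (\<psi> ((f ^^ k) x)) = \<psi> x" if "x \<in> D" for k x
    using that
  proof (induction k)
    case (Suc k)
    let ?z = "(f ^^ k) x"
    have "?z \<in> D" using Suc.prems by (rule pow_D)
    then have "f (\<psi> (f ?z)) = \<psi> ?z" using \<phi> \<psi> by (simp add: f_def)
    then show ?case using Suc by (simp add: funpow_swap1)
  qed simp
  \<comment> \<open>the midpoint \<open>y\<close> between \<open>x\<close> and \<open>\<psi> x\<close> is fixed by \<open>\<psi>\<close>, or \<open>\<psi> y\<close> is fixed by \<open>\<phi>\<close>\<close>
  have apart: "\<psi> x \<noteq> (f ^^ m) x" if x: "x \<in> D" for m x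
  proof
    assume eq: "\<psi> x = (f ^^ m) x"
    define k where "k = m div 2"
    define y where "y = (f ^^ k) x"
    have y: "y \<in> D" using x unfolding y_def by (rule pow_D)
    have "(f ^^ k) (\<psi> y) = (f ^^ m) x" using flip[OF x] eq by (simp add: y_def)
    show False
    proof (cases "even m")
      case True
      then have "m = k + k" by (auto simp: k_def)
      then have "(f ^^ k) (\<psi> y) = (f ^^ k) y"
        using \<open>(f ^^ k) (\<psi> y) = _\<close> by (simp add: y_def funpow_add)
      then show False using pow_inj y \<psi> by blast
    next
      case False
      then have "m = k + Suc k" by (auto simp: k_def elim!: oddE)
      then have "(f ^^ k) (\<psi> y) = (f ^^ k) (f y)"
        using \<open>(f ^^ k) (\<psi> y) = _\<close> by (simp only: y_def funpow_add comp_apply funpow.simps)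
      then have "\<psi> y = f y" using pow_inj y \<psi> f_D by blast
      then show False using y \<phi> \<psi> by (metis comp_apply f_def)
    qed
  qed
  have "\<not> inj (\<lambda>k. (f ^^ k) h0)"
  proof
    assume "inj (\<lambda>k. (f ^^ k) h0)"
    then have "infinite (range (\<lambda>k. (f ^^ k) h0))" by (simp add: finite_image_iff)
    moreover have "range (\<lambda>k. (f ^^ k) h0) \<subseteq> D" using pow_D \<open>h0 \<in> D\<close> by blast
    ultimately show False using fin finite_subset by blast
  qed
  then obtain i j where "i < j" "(f ^^ i) h0 = (f ^^ j) h0"
    by (metis injI linorder_neqE_nat)
  moreover from this have "(f ^^ j) h0 = (f ^^ i) ((f ^^ (j - i)) h0)"
    by (metis funpow_add comp_apply le_add_diff_inverse less_imp_le)
  ultimately have "0 < j - i \<and> (f ^^ (j - i)) h0 = h0"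
    using pow_inj pow_D \<open>h0 \<in> D\<close> by (metis zero_less_diff)
  then have ex: "\<exists>n. 0 < n \<and> (f ^^ n) h0 = h0" by blast
  define n where "n = (LEAST n. 0 < n \<and> (f ^^ n) h0 = h0)"
  have n: "0 < n" "(f ^^ n) h0 = h0" using LeastI_ex[OF ex] by (auto simp: n_def)
  have n_least: "(f ^^ m) h0 \<noteq> h0" if "0 < m" "m < n" for m
    using that not_less_Least[of m] by (auto simp: n_def)
  define h where "h i = (f ^^ i) h0" for i
  have h_D: "h i \<in> D" for i using pow_D \<open>h0 \<in> D\<close> by (simp add: h_def)
  have h_Suc: "h (Suc i) = \<phi> (\<psi> (h i))" for i by (simp add: h_def f_def)
  have h_add: "h (i + m) = (f ^^ m) (h i)" for i m
    unfolding h_def add.commute[of i] by (simp add: funpow_add)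
  have h_ne: "h i \<noteq> h j" if "i < j" "j < n" for i j
  proof
    assume "h i = h j"
    then have "(f ^^ i) h0 = (f ^^ i) ((f ^^ (j - i)) h0)"
      using that h_add[of "j - i" i] by (simp add: h_def)
    then have "(f ^^ (j - i)) h0 = h0" using pow_inj pow_D \<open>h0 \<in> D\<close> by metis
    moreover have "0 < j - i" "j - i < n" using that by linarith+
    ultimately show False using n_least by blast
  qed
  have h_\<psi>: "\<psi> (h i) \<noteq> h j" for i j
  proof (cases "i \<le> j")
    case True
    then show ?thesis using apart[OF h_D[of i], of "j - i"] h_add[of i "j - i"] by simp
  next
    case False
    then have "h i \<noteq> \<psi> (h j)" using apart[OF h_D[of j], of "i - j"] h_add[of j "i - j"] by simp
    then show ?thesis using \<psi>[OF h_D[of i]] by metis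
  qed
  have cover: "\<exists>i<n. x = h i \<or> x = \<psi> (h i)" if "x \<in> D" for x
  proof -
    define O' where "O' = {y. \<exists>i<n. y = h i \<or> y = \<psi> (h i)}"
    have O_D: "y \<in> D" if "y \<in> O'" for y using that h_D \<psi> by (auto simp: O'_def)
    have O\<psi>: "\<psi> y \<in> O'" if "y \<in> O'" for y
      using that h_D \<psi> by (force simp: O'_def)
    have O\<phi>: "\<phi> y \<in> O'" if y: "y \<in> O'" for y
    proof -
      obtain i where i: "i < n" "y = h i \<or> y = \<psi> (h i)" using y by (auto simp: O'_def)
      have hn: "h n = h 0" using n by (simp add: h_def)
      from i(2) show ?thesis
      proof
        assume "y = \<psi> (h i)"
        then have "\<phi> y = h (Suc i)" by (simp add: h_Suc)
        moreover have "h (Suc i) \<in> O'"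
          using i(1) n(1) hn unfolding O'_def by (cases "Suc i = n") (auto, metis Suc_lessI)
        ultimately show ?thesis by simp
      next
        assume "y = h i"
        have "\<exists>j<n. y = h (Suc j)"
        proof (cases i)
          case 0
          then show ?thesis using hn n \<open>y = h i\<close> by (intro exI[of _ "n - 1"]) auto
        next
          case (Suc j)
          then show ?thesis using i \<open>y = h i\<close> by (intro exI[of _ j]) simp
        qed
        then obtain j where j: "j < n" "y = h (Suc j)" by blast
        then have "\<phi> y = \<psi> (h j)" using h_Suc \<phi> \<psi> h_D by metis
        with j show ?thesis by (auto simp: O'_def)
      qed
    qed
    have "x \<in> O'"
      using conn[OF that]
    proof (induction rule: equivclp_induct)
      case base
      show ?case using n(1) by (auto simp: O'_def h_def intro: exI[of _ 0])
    next
      case (step y z)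
      then show ?case using O\<psi> O\<phi> O_D \<phi> \<psi> by metis
    qed
    then show ?thesis by (simp add: O'_def)
  qed
  show thesis
  proof (rule that[of n h])
    show "i = j" if "i < n" "j < n" "h j = h i \<or> h j = \<psi> (h i)" for i j
      using that h_ne h_\<psi> by (metis linorder_neqE_nat)
  qed (use n h_Suc h_D cover in \<open>auto simp: h_def\<close>)
qed

section \<open>Hamilton cycles and connectedness\<close>

text \<open>
  The heads of its arcs list the vertices of a closed walk without the initial one, which recurs at
  the end; so their distinctness is the condition on cycles.
\<close>

lemma hamiltonian_iff_closed_walk:
  "hamiltonian H \<longleftrightarrow>
     (\<exists>u p. set p \<subseteq> parcs H \<and> pcas u p u \<and> distinct (map snd p) \<and> 3 \<le> length p \<and>
        fst ` set p = pverts H)"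
proof -
  have *: "(u \<in> pverts H \<and> set p \<subseteq> parcs H \<and> pcas u p u \<and>
          distinct (tl (pre_digraph.awalk_verts (with_proj H) u p)) \<and> p \<noteq> []) \<longleftrightarrow>
        set p \<subseteq> parcs H \<and> pcas u p u \<and> distinct (map snd p)"
    if "3 \<le> length p" "fst ` set p = pverts H" for u p
  proof (cases "set p \<subseteq> parcs H \<and> pcas u p u")
    case True
    then have "u \<in> pverts H" using that by (cases p) auto
    moreover have "p \<noteq> []" using that(1) by auto
    then have "pre_digraph.awalk_verts (with_proj H) u p = fst (hd p) # map snd p"
      using True by (subst pre_digraph.awalk_verts_conv') (auto simp: cas_with_proj_eq)
    ultimately show ?thesis using that True by auto
  qed auto
  show ?thesis
    unfolding hamiltonian_def pre_digraph.cycle_def pre_digraph.awalk_def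
    using * by (simp add: cas_with_proj_eq) blast
qed

lemma hamiltonian_if_cyclic_sequence:
  fixes f :: "nat \<Rightarrow> 'b"
  assumes "3 \<le> n" "f n = f 0" "inj_on f {..<n}" "f ` {..<n} = pverts H"
    and arcs: "\<And>i. i < n \<Longrightarrow> (f i, f (Suc i)) \<in> parcs H"
  shows "hamiltonian H"
proof -
  define p where "p = map (\<lambda>i. (f i, f (Suc i))) [0..<n]"
  have "pcas (f m) (map (\<lambda>i. (f i, f (Suc i))) [m..<m + k]) (f (m + k))" for m k
  proof (induction k arbitrary: m)
    case (Suc k)
    have "[m..<m + Suc k] = m # [Suc m..<Suc m + k]" by (simp add: upt_conv_Cons)
    with Suc[of "Suc m"] show ?case by simp
  qed simp
  from this[of 0 n] have "pcas (f 0) p (f 0)" using assms(2) by (simp add: p_def)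
  moreover have "inj_on (f \<circ> Suc) {..<n}"
  proof (rule inj_onI)
    fix i j assume ij: "i \<in> {..<n}" "j \<in> {..<n}" "(f \<circ> Suc) i = (f \<circ> Suc) j"
    have "f (Suc i mod n) = f (Suc i)" if "i < n" for i
      using that assms(2) by (cases "Suc i = n") auto
    then have "f (Suc i mod n) = f (Suc j mod n)" using ij by simp
    then have "Suc i mod n = Suc j mod n"
      using assms(1) by (intro inj_onD[OF assms(3)]) auto
    then show "i = j" using ij by (cases "Suc i = n"; cases "Suc j = n") auto
  qed
  then have "distinct (map snd p)"
    by (auto simp: p_def distinct_map comp_def inj_on_def)
  moreover have "fst ` set p = pverts H"
    using assms(4) by (auto simp: p_def image_image atLeast0LessThan)
  moreover have "set p \<subseteq> parcs H" "3 \<le> length p"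
    using arcs assms(1) by (auto simp: p_def)
  ultimately show ?thesis
    unfolding hamiltonian_iff_closed_walk by blast
qed

lemma (in pair_graph) connected_iff_rtrancl:
  "connected (with_proj G) \<longleftrightarrow>
     pverts G \<noteq> {} \<and> (\<forall>a\<in>pverts G. \<forall>b\<in>pverts G. (a, b) \<in> (parcs G)\<^sup>*)"
proof -
  have "a \<rightarrow>\<^sup>*\<^bsub>with_proj (mk_symmetric (with_proj G))\<^esub> b \<longleftrightarrow> (a, b) \<in> (parcs G)\<^sup>*" if "a \<in> pverts G" for a b
    using reachable_mk_symmetric_eq[OF pair_sym_arcs, of a b] reachable_conv'[of a b] that by simp
  then show ?thesis
    unfolding connected_def strongly_connected_def by (simp add: mk_symmetric_def)
qed

lemma (in pair_graph) connected_if_hamiltonian: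
  assumes "hamiltonian G"
  shows "connected (with_proj G)"
proof -
  have *: "pcas u p v \<Longrightarrow> set p \<subseteq> parcs G \<Longrightarrow> (u, v) \<in> (parcs G)\<^sup>* \<and> (\<forall>e\<in>set p. (fst e, v) \<in> (parcs G)\<^sup>*)"
    for u v p
    by (induction p arbitrary: u) (auto intro: converse_rtrancl_into_rtrancl)
  obtain u p where p: "set p \<subseteq> parcs G" "pcas u p u" "3 \<le> length p" "fst ` set p = pverts G"
    using assms unfolding hamiltonian_iff_closed_walk by blast
  have to_u: "(a, u) \<in> (parcs G)\<^sup>*" if "a \<in> pverts G" for a
  proof -
    have "a \<in> fst ` set p" using that p(4) by simp
    then show ?thesis using *[OF p(2,1)] by (elim imageE) simp
  qed
  have "sym ((parcs G)\<^sup>*)" using pair_sym_arcs by (auto simp: symmetric_def intro: sym_rtrancl)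
  with to_u have "(a, b) \<in> (parcs G)\<^sup>*" if "a \<in> pverts G" "b \<in> pverts G" for a b
    using that by (meson rtrancl_trans symD)
  moreover have "pverts G \<noteq> {}" using p(3,4) by auto
  ultimately show ?thesis by (simp add: connected_iff_rtrancl)
qed

section \<open>Joining the closed walks through a vertex\<close>

context pair_graph
begin

definition nbrs :: "'a \<Rightarrow> 'a set" where
  "nbrs u = {v. (u, v) \<in> parcs G}"

definition half_edges :: "('a \<times> 'a \<times> bool) set" where
  "half_edges = {(u, x, b). (u, x) \<in> parcs G}"

definition flip :: "'a \<times> 'a \<times> bool \<Rightarrow> 'a \<times> 'a \<times> bool" where
  "flip = (\<lambda>(u, x, b). (x, u, b))"

definition labelled :: "('a \<Rightarrow> 'a \<times> bool \<Rightarrow> 'a) \<Rightarrow> bool" where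
  "labelled L \<longleftrightarrow> (\<forall>u. labelling (nbrs u) (L u))"

text \<open>
  Restricting the use of labels to the vertices in \<open>W\<close> cuts the closed walks at the other vertices:
  with \<open>W = - {w}\<close>, what remains linked are the paths that avoid passing through \<open>w\<close>.
\<close>

definition link :: "('a \<Rightarrow> 'a \<times> bool \<Rightarrow> 'a) \<Rightarrow> 'a set \<Rightarrow> 'a \<times> 'a \<times> bool \<Rightarrow> 'a \<times> 'a \<times> bool \<Rightarrow> bool" where
  "link L W h h' \<longleftrightarrow> h \<in> half_edges \<and> h' \<in> half_edges \<and>
     (h' = flip h \<or> fst h' = fst h \<and> fst h \<in> W \<and> L (fst h) (snd h) = L (fst h) (snd h'))"

abbreviation joined :: "('a \<Rightarrow> 'a \<times> bool \<Rightarrow> 'a) \<Rightarrow> 'a \<times> 'a \<times> bool \<Rightarrow> 'a \<times> 'a \<times> bool \<Rightarrow> bool" where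
  "joined L \<equiv> equivclp (link L UNIV)"

lemma arc_sym: "(u, v) \<in> parcs G \<Longrightarrow> (v, u) \<in> parcs G"
  using pair_sym_arcs by (auto simp: symmetric_def elim: symE)

lemma finite_nbrs: "finite (nbrs u)"
  using finite_imageI[OF pair_finite_arcs, of snd] by (rule rev_finite_subset) (force simp: nbrs_def)

lemma finite_half_edges: "finite half_edges"
proof -
  have "half_edges \<subseteq> (\<lambda>((u, x), b). (u, x, b)) ` (parcs G \<times> UNIV)"
    by (force simp: half_edges_def)
  then show ?thesis by (rule finite_subset) (simp add: pair_finite_arcs)
qed

lemma Pair_in_half_edges: "(u, k) \<in> half_edges \<longleftrightarrow> k \<in> nbrs u \<times> UNIV"
  by (cases k) (simp add: half_edges_def nbrs_def)

lemma flip_half_edge: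
  assumes "h \<in> half_edges"
  shows "flip h \<in> half_edges \<and> flip h \<noteq> h \<and> flip (flip h) = h"
  using assms pair_no_loops by (force simp: half_edges_def flip_def intro: arc_sym)

lemma labelledD:
  assumes "labelled L" "k \<in> nbrs u \<times> UNIV"
  shows "L u k \<in> nbrs u" "L u k \<noteq> fst k"
  using assms unfolding labelled_def labelling_def by blast+

lemma labelled_card:
  assumes "labelled L" "v \<in> nbrs u"
  shows "card {k \<in> nbrs u \<times> UNIV. L u k = v} = 2"
  using assms unfolding labelled_def labelling_def by blast

text \<open>
  A class \<open>C\<close> of half-edges that are linked without passing through \<open>w\<close> has even size, because it
  contains the other end of each of its edges. Its part away from \<open>w\<close> has even size as well, because
  it contains the other half-edge of each visit there. So its part at \<open>w\<close> is even.
\<close>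

lemma even_link_classes:
  assumes L: "labelled L"
  shows "even (card {k' \<in> nbrs w \<times> UNIV. equivclp (link L (- {w})) (w, k) (w, k')})"
proof -
  let ?E = "equivclp (link L (- {w}))"
  define C where "C = {h \<in> half_edges. ?E (w, k) h}"
  define C0 where "C0 = {h \<in> C. fst h \<noteq> w}"
  define K where "K = {k' \<in> nbrs w \<times> UNIV. ?E (w, k) (w, k')}"
  have fin: "finite C" using finite_half_edges by (simp add: C_def)
  have "even (card C)"
  proof (rule even_card_if_involution[OF fin])
    fix h assume h: "h \<in> C"
    then have "link L (- {w}) h (flip h)" using flip_half_edge by (simp add: C_def link_def)
    with h show "flip h \<in> C \<and> flip h \<noteq> h \<and> flip (flip h) = h"
      using flip_half_edge by (auto simp: C_def intro: equivclp_into_equivclp)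
  qed
  moreover have "even (card C0)"
  proof (rule even_card_if_fibres_doubletons[where g = "\<lambda>h. (fst h, L (fst h) (snd h))"])
    show "finite C0" using fin by (simp add: C0_def)
    fix h assume h: "h \<in> C0"
    obtain u k1 where uk: "h = (u, k1)" by (cases h)
    have k1: "k1 \<in> nbrs u \<times> UNIV" "u \<noteq> w" "?E (w, k) (u, k1)"
      using h uk by (auto simp: C0_def C_def Pair_in_half_edges simp del: mem_Sigma_iff)
    have "(u, k2) \<in> C" if "k2 \<in> nbrs u \<times> UNIV" "L u k2 = L u k1" for k2
    proof -
      have "link L (- {w}) (u, k1) (u, k2)"
        using that k1 by (simp add: link_def Pair_in_half_edges del: mem_Sigma_iff)
      with k1 that show ?thesis
        by (auto simp: C_def Pair_in_half_edges simp del: mem_Sigma_iff intro: equivclp_into_equivclp)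
    qed
    then have "{y \<in> C0. (fst y, L (fst y) (snd y)) = (fst h, L (fst h) (snd h))} =
        Pair u ` {k2 \<in> nbrs u \<times> UNIV. L u k2 = L u k1}"
      using k1(2) uk by (auto simp: C0_def C_def Pair_in_half_edges simp del: mem_Sigma_iff)
    then show "card {y \<in> C0. (fst y, L (fst y) (snd y)) = (fst h, L (fst h) (snd h))} = 2"
      using labelled_card[OF L labelledD(1)[OF L k1(1)]] by (simp add: card_image inj_on_def)
  qed
  moreover have C_eq: "C = C0 \<union> Pair w ` K"
    by (auto simp: C0_def C_def K_def Pair_in_half_edges simp del: mem_Sigma_iff)
  have "finite C0" "finite (Pair w ` K)"
    using fin unfolding C_eq by blast+
  then have "card (C0 \<union> Pair w ` K) = card C0 + card (Pair w ` K)"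
    by (rule card_Un_disjoint) (auto simp: C0_def)
  with C_eq have "card C = card C0 + card K" by (simp add: card_image inj_on_def)
  ultimately show ?thesis by (simp add: K_def)
qed

text \<open>
  Links away from \<open>w\<close> survive the replacement of the labelling at \<open>w\<close>, and the old links at \<open>w\<close> are
  harmless to lose, because afterwards all half-edges at \<open>w\<close> are joined.
\<close>

lemma join_at_vertex:
  assumes L: "labelled L" and deg: "3 \<le> card (nbrs w)"
  obtains L' where "labelled L'"
    "\<And>k k'. k \<in> nbrs w \<times> UNIV \<Longrightarrow> k' \<in> nbrs w \<times> UNIV \<Longrightarrow> joined L' (w, k) (w, k')"
    "\<And>h h'. joined L h h' \<Longrightarrow> joined L' h h'"
proof -
  let ?S = "nbrs w \<times> (UNIV :: bool set)"
  define E where "E k k' \<longleftrightarrow> equivclp (link L (- {w})) (w, k) (w, k')" for k k'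
  have "equivp E"
    by (rule equivpI) (auto simp: E_def reflp_def symp_def transp_def intro: equivclp_sym equivclp_trans)
  then obtain l where l: "labelling (nbrs w) l"
    "\<And>k k'. k \<in> ?S \<Longrightarrow> k' \<in> ?S \<Longrightarrow> equivclp (\<lambda>a b. a \<in> ?S \<and> b \<in> ?S \<and> (E a b \<or> l a = l b)) k k'"
    by (rule joining_labelling[OF finite_nbrs deg]) (use even_link_classes[OF L] in \<open>simp_all add: E_def\<close>)
  define L' where "L' = L(w := l)"
  have off: "joined L' h h'" if "equivclp (link L (- {w})) h h'" for h h'
    using that by (rule equivclp_least) (auto simp: link_def L'_def intro!: r_into_equivclp)
  have at: "joined L' (w, k) (w, k')" if "k \<in> ?S" "k' \<in> ?S" for k k'
    using l(2)[OF that]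
  proof induction
    case (step y z)
    have once: "joined L' (w, a) (w, b)" if "a \<in> ?S \<and> b \<in> ?S \<and> (E a b \<or> l a = l b)" for a b
    proof (cases "E a b")
      case True
      then show ?thesis using off by (simp add: E_def)
    next
      case False
      with that have "link L' UNIV (w, a) (w, b)"
        by (simp add: link_def L'_def Pair_in_half_edges del: mem_Sigma_iff)
      then show ?thesis by (rule r_into_equivclp)
    qed
    from step.hyps(2) have "joined L' (w, y) (w, z)"
      by (elim disjE) (rule once, assumption, rule equivclp_sym[OF once], assumption)
    with step.IH show ?case by (rule equivclp_trans)
  qed simp
  show thesis
  proof (rule that)
    show "labelled L'" using L l(1) by (simp add: labelled_def L'_def)
    show "joined L' h h'" if "joined L h h'" for h h'
      using that
    proof (rule equivclp_least)
      fix a b assume ab: "link L UNIV a b"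
      show "joined L' a b"
      proof (cases "fst a = w \<and> fst b = w")
        case True
        with ab show ?thesis
          using at[of "snd a" "snd b"] by (cases a; cases b) (simp add: link_def Pair_in_half_edges del: mem_Sigma_iff)
      next
        case False
        with ab have "link L (- {w}) a b" by (auto simp: link_def)
        then show ?thesis using off by blast
      qed
    qed
  qed (use at in blast)
qed

text \<open>
  A vertex that has been treated stays joined when later ones are treated, since joining at a vertex
  only coarsens the partition into closed walks.
\<close>

lemma join_at_vertices:
  assumes deg: "\<And>u v. (u, v) \<in> parcs G \<Longrightarrow> 2 \<le> card (nbrs u)"
  obtains L where "labelled L"
    "\<And>w k k'. 3 \<le> card (nbrs w) \<Longrightarrow> k \<in> nbrs w \<times> UNIV \<Longrightarrow> k' \<in> nbrs w \<times> UNIV \<Longrightarrow>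
       joined L (w, k) (w, k')"
proof -
  have "\<exists>L. labelled L \<and> (\<forall>w\<in>W. \<forall>k\<in>nbrs w \<times> UNIV. \<forall>k'\<in>nbrs w \<times> UNIV. joined L (w, k) (w, k'))"
    if "finite W" "\<And>w. w \<in> W \<Longrightarrow> 3 \<le> card (nbrs w)" for W
    using that
  proof (induction W)
    case empty
    have "\<exists>l. labelling (nbrs u) l" for u
    proof (cases "nbrs u = {}")
      case True
      then show ?thesis by (simp add: labelling_def)
    next
      case False
      then have "2 \<le> card (nbrs u)" using deg by (auto simp: nbrs_def)
      then show ?thesis using ex_labelling[OF finite_nbrs] by metis
    qed
    then have "\<exists>L. labelled L" unfolding labelled_def by metis
    then show ?case by simp
  next
    case (insert w W)
    then obtain L where L: "labelled L"
      "\<forall>w\<in>W. \<forall>k\<in>nbrs w \<times> UNIV. \<forall>k'\<in>nbrs w \<times> UNIV. joined L (w, k) (w, k')" by auto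
    obtain L' where L': "labelled L'"
      "\<And>k k'. k \<in> nbrs w \<times> UNIV \<Longrightarrow> k' \<in> nbrs w \<times> UNIV \<Longrightarrow> joined L' (w, k) (w, k')"
      "\<And>h h'. joined L h h' \<Longrightarrow> joined L' h h'"
      using join_at_vertex[OF L(1)] insert.prems by (metis insertI1)
    then show ?case using L(2) by (intro exI[of _ L']) blast
  qed
  moreover have "finite {w. 3 \<le> card (nbrs w)}"
  proof (rule finite_subset)
    show "{w. 3 \<le> card (nbrs w)} \<subseteq> pverts G"
    proof
      fix w assume "w \<in> {w. 3 \<le> card (nbrs w)}"
      then have "nbrs w \<noteq> {}" by auto
      then show "w \<in> pverts G" by (auto simp: nbrs_def intro: in_arcsD1)
    qed
  qed (rule pair_finite_verts)
  ultimately obtain L where "labelled L" "\<forall>w\<in>{w. 3 \<le> card (nbrs w)}.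
      \<forall>k\<in>nbrs w \<times> UNIV. \<forall>k'\<in>nbrs w \<times> UNIV. joined L (w, k) (w, k')" by blast
  then show thesis by (intro that[of L]) blast+
qed

end

section \<open>Hamilton cycles of connected 3-arc graphs\<close>

lemma three_arc_graph_verts [simp]: "pverts (three_arc_graph G) = parcs G"
  by (simp add: three_arc_graph_def)

context pair_graph
begin

lemma three_arc_graph_arc_iff:
  "((u, v), (x, y)) \<in> parcs (three_arc_graph G) \<longleftrightarrow>
     (v, u) \<in> parcs G \<and> (u, x) \<in> parcs G \<and> (x, y) \<in> parcs G \<and> v \<noteq> x \<and> u \<noteq> y"
  by (simp add: three_arc_graph_def three_arc_iff)

text \<open>
  The single closed walk meets each visit once, and visits correspond to arcs of \<open>G\<close> through their
  names. If it leaves $u$ towards $x$ after a visit named $v$, and its next visit, at $x$, is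
  named $y$, then $v \ne x$ and $y \ne u$ as labels avoid their own ends, so
  $(v, u, x, y)$ is a 3-arc.
\<close>

lemma hamiltonian_three_arc_graph_if_all_joined:
  assumes deg: "\<And>u v. (u, v) \<in> parcs G \<Longrightarrow> 2 \<le> card (nbrs u)" and "parcs G \<noteq> {}"
    and L: "labelled L" and all: "\<And>h h'. h \<in> half_edges \<Longrightarrow> h' \<in> half_edges \<Longrightarrow> joined L h h'"
  shows "hamiltonian (three_arc_graph G)"
proof -
  define fibre where "fibre u k = {k' \<in> nbrs u \<times> UNIV. L u k' = L u k}" for u k
  have card_fibre: "card (fibre u k) = 2" if "k \<in> nbrs u \<times> UNIV" for u k
    unfolding fibre_def using labelled_card[OF L labelledD(1)[OF L that]] .
  have ex_mate: "\<exists>k'. k' \<noteq> k \<and> fibre u k = {k, k'}" if k: "k \<in> nbrs u \<times> UNIV" for u k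
  proof -
    have "k \<in> fibre u k" using k by (simp add: fibre_def)
    with card_fibre[OF k] show ?thesis by (rule doubleton_other_element)
  qed
  define mate where "mate u k = (SOME k'. k' \<noteq> k \<and> fibre u k = {k, k'})" for u k
  have mate: "mate u k \<noteq> k \<and> fibre u k = {k, mate u k}" if "k \<in> nbrs u \<times> UNIV" for u k
    unfolding mate_def using someI_ex[OF ex_mate[OF that]] .
  define partner where "partner h = (fst h, mate (fst h) (snd h))" for h
  define label where "label h = (fst h, L (fst h) (snd h))" for h
  have partner_iff: "h' \<in> half_edges \<and> label h' = label h \<longleftrightarrow> h' = h \<or> h' = partner h"
    if h: "h \<in> half_edges" for h h'
  proof -
    obtain u k u' k' where uk: "h = (u, k)" "h' = (u', k')" by (cases h; cases h')
    have k: "k \<in> nbrs u \<times> UNIV" using h uk by (simp add: Pair_in_half_edges del: mem_Sigma_iff)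
    have "h' \<in> half_edges \<and> label h' = label h \<longleftrightarrow> u' = u \<and> k' \<in> fibre u k"
      by (auto simp: uk label_def fibre_def Pair_in_half_edges simp del: mem_Sigma_iff)
    also have "\<dots> \<longleftrightarrow> h' = h \<or> h' = partner h"
      using mate[OF k] by (auto simp: uk partner_def)
    finally show ?thesis .
  qed
  have partner_ne: "partner h \<noteq> h" if "h \<in> half_edges" for h
    using that mate[of "snd h" "fst h"] Pair_in_half_edges[of "fst h" "snd h"]
    by (cases h) (auto simp: partner_def)
  have partner: "partner h \<in> half_edges \<and> partner h \<noteq> h \<and> partner (partner h) = h"
    if h: "h \<in> half_edges" for h
  proof -
    have 1: "partner h \<in> half_edges" "label (partner h) = label h" 
      using partner_iff[OF h, of "partner h"] by auto
    then have "h = partner h \<or> h = partner (partner h)" using partner_iff[OF 1(1), of h] h by simp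
    with 1 partner_ne[OF h] show ?thesis by auto
  qed
  obtain u0 v0 where "(u0, v0) \<in> parcs G" using \<open>parcs G \<noteq> {}\<close> by auto
  then have h0: "(u0, v0, True) \<in> half_edges" by (simp add: half_edges_def)
  have conn: "equivclp (\<lambda>a b. a \<in> half_edges \<and> (b = flip a \<or> b = partner a)) (u0, v0, True) h"
    if h: "h \<in> half_edges" for h
    using all[OF h0 h]
  proof (rule equivclp_least)
    fix a b assume ab: "link L UNIV a b"
    then have "b = flip a \<or> b = a \<or> b = partner a"
      using partner_iff[of a b] by (auto simp: link_def label_def)
    moreover have "a \<in> half_edges" using ab by (simp add: link_def)
    ultimately show "equivclp (\<lambda>a b. a \<in> half_edges \<and> (b = flip a \<or> b = partner a)) a b"
      by (elim disjE) auto
  qed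
  obtain h n where h: "0 < n" "h n = h 0" "\<And>i. h (Suc i) = flip (partner (h i))"
    "\<And>i. h i \<in> half_edges" "\<And>i j. i < n \<Longrightarrow> j < n \<Longrightarrow> h j = h i \<or> h j = partner (h i) \<Longrightarrow> i = j"
    "\<And>x. x \<in> half_edges \<Longrightarrow> \<exists>i<n. x = h i \<or> x = partner (h i)"
    by (rule alternating_cycle[OF finite_half_edges h0 flip_half_edge partner conn]) blast+
  define f where "f i = label (h i)" for i
  have inj: "inj_on f {..<n}"
  proof (rule inj_onI)
    fix i j assume "i \<in> {..<n}" "j \<in> {..<n}" "f i = f j"
    then show "i = j"
      using h(5)[of i j] partner_iff[OF h(4)[of i], of "h j"] h(4)[of j] by (simp add: f_def)
  qed
  have label_arc: "label x \<in> parcs G" if x: "x \<in> half_edges" for x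
    using labelledD(1)[OF L, of "snd x" "fst x"] Pair_in_half_edges[of "fst x" "snd x"] x
    by (simp add: label_def nbrs_def)
  have img: "f ` {..<n} = parcs G"
  proof
    show "f ` {..<n} \<subseteq> parcs G" unfolding f_def by (intro image_subsetI label_arc h(4))
    show "parcs G \<subseteq> f ` {..<n}"
    proof
      fix a assume a: "a \<in> parcs G"
      obtain u v where uv: "a = (u, v)" by (cases a)
      have "card {k \<in> nbrs u \<times> UNIV. L u k = v} = 2"
        using a uv by (intro labelled_card[OF L]) (simp add: nbrs_def)
      then have "{k \<in> nbrs u \<times> UNIV. L u k = v} \<noteq> {}" by force
      then obtain k where k: "k \<in> nbrs u \<times> UNIV" "L u k = v" by blast
      then have uk: "(u, k) \<in> half_edges" "label (u, k) = a"
        by (simp_all add: Pair_in_half_edges label_def uv del: mem_Sigma_iff)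
      obtain i where i: "i < n" "(u, k) = h i \<or> (u, k) = partner (h i)" using h(6)[OF uk(1)] by blast
      then have "label (u, k) = label (h i)" using partner_iff[OF h(4)[of i], of "(u, k)"] by blast
      with i(1) uk(2) show "a \<in> f ` {..<n}" by (auto simp: f_def)
    qed
  qed
  have step: "(f i, f (Suc i)) \<in> parcs (three_arc_graph G)" for i
  proof -
    obtain u x b where p: "partner (h i) = (u, x, b)" by (cases "partner (h i)")
    have "partner (h i) \<in> half_edges" "label (partner (h i)) = f i"
      using partner_iff[OF h(4)[of i], of "partner (h i)"] by (auto simp: f_def)
    then have f_i: "f i = (u, L u (x, b))" and ux: "(u, x, b) \<in> half_edges" by (simp_all add: p label_def)
    have hS: "h (Suc i) = (x, u, b)" by (simp add: h(3) p flip_def)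
    then have f_S: "f (Suc i) = (x, L x (u, b))" by (simp add: f_def label_def)
    have xu: "(x, u, b) \<in> half_edges" using h(4)[of "Suc i"] hS by simp
    show ?thesis
      using labelledD[OF L, of "(x, b)" u] labelledD[OF L, of "(u, b)" x] ux xu
      by (auto simp: f_i f_S three_arc_graph_arc_iff half_edges_def nbrs_def intro: arc_sym)
  qed
  have "3 \<le> n"
  proof -
    have "\<exists>w. w \<noteq> v0 \<and> (u0, w) \<in> parcs G"
    proof (rule ccontr)
      assume "\<not> ?thesis"
      then have "nbrs u0 \<subseteq> {v0}" by (auto simp: nbrs_def)
      then have "card (nbrs u0) \<le> 1" using card_mono[of "{v0}"] by simp
      with deg[OF \<open>(u0, v0) \<in> parcs G\<close>] show False by simp
    qed
    then obtain w where w: "w \<noteq> v0" "(u0, w) \<in> parcs G" by blast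
    have "u0 \<noteq> v0" using pair_no_loops[OF \<open>(u0, v0) \<in> parcs G\<close>] by simp
    with w have "card {(u0, v0), (u0, w), (v0, u0)} = 3" by simp
    moreover have "{(u0, v0), (u0, w), (v0, u0)} \<subseteq> parcs G"
      using w \<open>(u0, v0) \<in> parcs G\<close> arc_sym by simp
    ultimately have "3 \<le> card (parcs G)" using pair_finite_arcs by (metis card_mono)
    also have "\<dots> = n" using card_image[OF inj] img by simp
    finally show ?thesis .
  qed
  show ?thesis
    by (rule hamiltonian_if_cyclic_sequence[of n f]) (use \<open>3 \<le> n\<close> h(2) inj img step in \<open>auto simp: f_def\<close>)
qed

text \<open>
  Let \<open>Q (u, v)\<close> consist of the half-edges at $u$ that do not lead to $v$. All of them lie on one
  closed walk: if $u$ has degree two, they are the two copies of the same half-edge and have the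
  label $v$ for lack of another choice; otherwise everything at $u$ is joined. If \<open>(u, v)\<close> and
  \<open>(x, y)\<close> are adjacent in $X(G)$, then the two ends of the edge $ux$ lie in \<open>Q (u, v)\<close> and
  \<open>Q (x, y)\<close>, so these lie on the same walk.
\<close>

lemma hamiltonian_three_arc_graph_if_connected:
  assumes conn: "connected (with_proj (three_arc_graph G))"
  shows "hamiltonian (three_arc_graph G)"
proof -
  interpret X: pair_graph "three_arc_graph G"
    by (rule pair_graph_three_arc_graph) unfold_locales
  have reach: "(a, b) \<in> (parcs (three_arc_graph G))\<^sup>*" if "a \<in> parcs G" "b \<in> parcs G" for a b
    using conn that by (simp add: X.connected_iff_rtrancl)
  have ne: "parcs G \<noteq> {}" using conn by (simp add: X.connected_iff_rtrancl)
  \<comment> \<open>no vertex is a leaf: otherwise its arc would be isolated in $X(G)$, while the reversed arc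
    is a second vertex of $X(G)$\<close>
  have other: "\<exists>x. x \<noteq> v \<and> (u, x) \<in> parcs G" if uv: "(u, v) \<in> parcs G" for u v
  proof -
    have "((u, v), (v, u)) \<in> (parcs (three_arc_graph G))\<^sup>*" by (rule reach[OF uv arc_sym[OF uv]])
    moreover have "(u, v) \<noteq> (v, u)" using pair_no_loops[OF uv] by auto
    ultimately obtain x y where "((u, v), (x, y)) \<in> parcs (three_arc_graph G)"
      by (metis converse_rtranclE surj_pair)
    then show ?thesis by (auto simp: three_arc_graph_arc_iff)
  qed
  have deg: "2 \<le> card (nbrs u)" if uv: "(u, v) \<in> parcs G" for u v
  proof -
    obtain x where "x \<noteq> v" "(u, x) \<in> parcs G" using other[OF uv] by blast
    then have "card {v, x} \<le> card (nbrs u)"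
      using uv finite_nbrs by (intro card_mono) (auto simp: nbrs_def)
    with \<open>x \<noteq> v\<close> show ?thesis by simp
  qed
  obtain L where L: "labelled L"
    "\<And>w k k'. 3 \<le> card (nbrs w) \<Longrightarrow> k \<in> nbrs w \<times> UNIV \<Longrightarrow> k' \<in> nbrs w \<times> UNIV \<Longrightarrow>
       joined L (w, k) (w, k')"
    by (rule join_at_vertices[OF deg]) blast+
  define Q where "Q a = {h \<in> half_edges. fst h = fst a \<and> fst (snd h) \<noteq> snd a}" for a
  have Q_joined: "joined L h h'" if hh': "h \<in> Q a" "h' \<in> Q a" and a: "a \<in> parcs G" for a h h'
  proof -
    obtain u v where uv: "a = (u, v)" by (cases a)
    obtain x b x' b' where h: "h = (u, x, b)" "h' = (u, x', b')"
      using hh' by (cases h; cases h') (auto simp: Q_def uv)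
    have mem: "x \<in> nbrs u" "x' \<in> nbrs u" "v \<in> nbrs u" "x \<noteq> v" "x' \<noteq> v"
      using hh' a by (auto simp: Q_def h uv half_edges_def nbrs_def)
    show ?thesis
    proof (cases "3 \<le> card (nbrs u)")
      case True
      then show ?thesis using L(2)[OF True, of "(x, b)" "(x', b')"] mem by (simp add: h)
    next
      case False
      then have card: "card (nbrs u) = 2" using deg[of u v] a uv by simp
      have nb: "nbrs u = {x, v}"
        using card mem card_seteq[OF finite_nbrs[of u], of "{x, v}"] by auto
      then have "x' = x" using mem by auto
      have "L u (x, c) = v" for c
        using labelledD[OF L(1), of "(x, c)" u] nb by auto
      moreover have "h \<in> half_edges" "h' \<in> half_edges" using hh' by (simp_all add: Q_def)
      ultimately have "link L UNIV h h'" by (simp add: link_def h \<open>x' = x\<close>)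
      then show ?thesis by (rule r_into_equivclp)
    qed
  qed
  have Q_reach: "\<forall>h\<in>Q a. \<forall>h'\<in>Q b. joined L h h'"
    if "(a, b) \<in> (parcs (three_arc_graph G))\<^sup>*" "a \<in> parcs G" for a b
    using that(1)
  proof induction
    case base
    show ?case using Q_joined that(2) by blast
  next
    case (step b c)
    obtain u v x y where bc: "b = (u, v)" "c = (x, y)" by (cases b; cases c)
    have arc: "(v, u) \<in> parcs G" "(u, x) \<in> parcs G" "(x, y) \<in> parcs G" "v \<noteq> x" "u \<noteq> y"
      using step.hyps(2) by (simp_all add: bc three_arc_graph_arc_iff)
    have Qb: "(u, x, True) \<in> Q b" and Qc: "(x, u, True) \<in> Q c"
      using arc by (auto simp: Q_def bc half_edges_def intro: arc_sym)
    have "(u, x, True) \<in> half_edges" "(x, u, True) \<in> half_edges"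
      using arc arc_sym by (simp_all add: half_edges_def)
    then have "link L UNIV (u, x, True) (x, u, True)" by (simp add: link_def flip_def)
    then have mid: "joined L (u, x, True) (x, u, True)" by (rule r_into_equivclp)
    show ?case
    proof (intro ballI)
      fix h h' assume h: "h \<in> Q a" "h' \<in> Q c"
      have "joined L h (u, x, True)" using step.IH h(1) Qb by blast
      also note mid
      also have "joined L (x, u, True) h'" using Q_joined[OF Qc h(2)] arc bc by simp
      finally show "joined L h h'" .
    qed
  qed
  have in_Q: "\<exists>a\<in>parcs G. h \<in> Q a" if hh: "h \<in> half_edges" for h
  proof -
    obtain u x b where h: "h = (u, x, b)" by (cases h)
    then have "(u, x) \<in> parcs G" using hh by (simp add: half_edges_def)
    then obtain v where "v \<noteq> x" "(u, v) \<in> parcs G" using other by blast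
    with hh h show ?thesis by (intro bexI[of _ "(u, v)"]) (auto simp: Q_def)
  qed
  show ?thesis
  proof (rule hamiltonian_three_arc_graph_if_all_joined[OF deg ne L(1)])
    show "joined L h h'" if "h \<in> half_edges" "h' \<in> half_edges" for h h'
      using in_Q[OF that(1)] in_Q[OF that(2)] Q_reach reach by blast
  qed
qed

end

section \<open>Iterating in minimum degree three\<close>

context pair_graph
begin

text \<open>
  With degree at least three, two arcs with common tail have a common neighbour in $X(G)$: an arc
  from a third neighbour that does not lead back. So paths of $G$ lift to $X(G)$.
\<close>

lemma three_arc_graph_connected:
  assumes conn: "connected (with_proj G)" and deg: "\<And>u. u \<in> pverts G \<Longrightarrow> 3 \<le> card (nbrs u)"
  shows "connected (with_proj (three_arc_graph G))"
proof -
  interpret X: pair_graph "three_arc_graph G"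
    by (rule pair_graph_three_arc_graph) unfold_locales
  let ?R = "(parcs (three_arc_graph G))\<^sup>*"
  have avoid: "\<exists>x. (u, x) \<in> parcs G \<and> x \<noteq> v \<and> x \<noteq> w" if "u \<in> pverts G" for u v w
  proof (rule ccontr)
    assume "\<not> ?thesis"
    then have "nbrs u \<subseteq> {v, w}" by (auto simp: nbrs_def)
    then have "card (nbrs u) \<le> card {v, w}" by (intro card_mono) auto
    also have "\<dots> \<le> 2" by (simp add: card_insert_if)
    finally show False using deg[OF that] by simp
  qed
  have cross: "((u, v), (x, y)) \<in> ?R"
    if "(u, v) \<in> parcs G" "(u, x) \<in> parcs G" "(x, y) \<in> parcs G" "v \<noteq> x" "u \<noteq> y" for u v x y
    using that by (intro r_into_rtrancl) (simp add: three_arc_graph_arc_iff arc_sym)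
  have same_tail: "((u, v), (u, w)) \<in> ?R" if uv: "(u, v) \<in> parcs G" "(u, w) \<in> parcs G" for u v w
  proof -
    obtain x where x: "(u, x) \<in> parcs G" "x \<noteq> v" "x \<noteq> w" using avoid uv in_arcsD1 by blast
    obtain y where y: "(x, y) \<in> parcs G" "y \<noteq> u" using avoid x in_arcsD2 by blast
    have "((u, v), (x, y)) \<in> ?R" using cross[of u v x y] uv x y by simp
    also have "((x, y), (u, w)) \<in> ?R" using cross[of x y u w] uv x y arc_sym by simp
    finally show ?thesis .
  qed
  have across: "((u, v), (x, y)) \<in> ?R"
    if arcs: "(u, v) \<in> parcs G" "(u, x) \<in> parcs G" "(x, y) \<in> parcs G" for u v x y
  proof -
    obtain v' where v': "(u, v') \<in> parcs G" "v' \<noteq> x" using avoid[of u x x] arcs(1) in_arcsD1 by blast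
    obtain y' where y': "(x, y') \<in> parcs G" "y' \<noteq> u" using avoid[of x u u] arcs(3) in_arcsD1 by blast
    have "((u, v), (u, v')) \<in> ?R" using same_tail arcs(1) v'(1) by blast
    also have "((u, v'), (x, y')) \<in> ?R" using cross[of u v' x y'] v' y' arcs(2) by simp
    also have "((x, y'), (x, y)) \<in> ?R" using same_tail arcs(3) y'(1) by blast
    finally show ?thesis .
  qed
  have reach: "\<forall>v y. (u, v) \<in> parcs G \<longrightarrow> (x, y) \<in> parcs G \<longrightarrow> ((u, v), (x, y)) \<in> ?R"
    if "(u, x) \<in> (parcs G)\<^sup>*" for u x
    using that
  proof induction
    case base
    show ?case using same_tail by blast
  next
    case (step x z)
    show ?case
    proof (intro allI impI)
      fix v y assume v: "(u, v) \<in> parcs G" and y: "(z, y) \<in> parcs G"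
      have "((u, v), (x, z)) \<in> ?R" using step v by blast
      also have "((x, z), (z, y)) \<in> ?R" using across step.hyps(2) y by blast
      finally show "((u, v), (z, y)) \<in> ?R" .
    qed
  qed
  have "parcs G \<noteq> {}" using conn avoid unfolding connected_iff_rtrancl by blast
  moreover have "(a, b) \<in> ?R" if "a \<in> parcs G" "b \<in> parcs G" for a b
  proof -
    obtain u v x y where ab: "a = (u, v)" "b = (x, y)" by (cases a; cases b)
    then have "(u, x) \<in> (parcs G)\<^sup>*"
      using conn that in_arcsD1 unfolding connected_iff_rtrancl by blast
    then show ?thesis using reach that ab by blast
  qed
  ultimately show ?thesis by (simp add: X.connected_iff_rtrancl)
qed

text \<open>
  The arc $uv$ is adjacent to each arc $xy$ with $x$ a neighbour of $u$ other than $v$ and $y$ a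
  neighbour of $x$ other than $u$; there are at least $2 \cdot 2$ of them.
\<close>

lemma three_arc_graph_degree:
  assumes deg: "\<And>u. u \<in> pverts G \<Longrightarrow> 3 \<le> card (nbrs u)" and a: "a \<in> parcs G"
  shows "3 \<le> card (pair_graph.nbrs (three_arc_graph G) a)"
proof -
  interpret X: pair_graph "three_arc_graph G"
    by (rule pair_graph_three_arc_graph) unfold_locales
  obtain u v where uv: "a = (u, v)" by (cases a)
  have Nx: "2 \<le> card (nbrs x - {u})" if "x \<in> pverts G" for x
    using deg[OF that] diff_card_le_card_Diff[of "{u}" "nbrs x"] by simp
  have "u \<in> pverts G" using a uv in_arcsD1 by blast
  then have "2 \<le> card (nbrs u - {v})"
    using deg[of u] diff_card_le_card_Diff[of "{v}" "nbrs u"] by simp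
  moreover have "(SIGMA x:nbrs u - {v}. nbrs x - {u}) \<subseteq> X.nbrs a"
    using a by (auto simp: X.nbrs_def nbrs_def uv three_arc_graph_arc_iff intro: arc_sym)
  then have "card (SIGMA x:nbrs u - {v}. nbrs x - {u}) \<le> card (X.nbrs a)"
    by (intro card_mono X.finite_nbrs)
  moreover have "card (SIGMA x:nbrs u - {v}. nbrs x - {u}) = (\<Sum>x\<in>nbrs u - {v}. card (nbrs x - {u}))"
    using finite_nbrs by (intro card_SigmaI) auto
  moreover have "\<dots> \<ge> (\<Sum>x\<in>nbrs u - {v}. 2)"
    using Nx in_arcsD2 by (intro sum_mono) (auto simp: nbrs_def)
  ultimately show ?thesis by simp
qed

end

definition connected_min_degree_3 :: "'a pair_pre_digraph \<Rightarrow> bool" where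
  "connected_min_degree_3 G \<longleftrightarrow> pair_graph G \<and> connected (with_proj G) \<and>
     (\<forall>u\<in>pverts G. 3 \<le> card {v. (u, v) \<in> parcs G})"

lemma connected_min_degree_3_iff:
  assumes "pair_graph G"
  shows "connected_min_degree_3 G \<longleftrightarrow> connected (with_proj G) \<and> 3 \<le> min_degree G"
proof -
  interpret pair_graph G by fact
  have "out_arcs (with_proj G) u = Pair u ` {v. (u, v) \<in> parcs G}" for u
    by (auto simp: out_arcs_def)
  then have "out_degree (with_proj G) u = card {v. (u, v) \<in> parcs G}" for u
    by (simp add: out_degree_def card_image inj_on_def)
  moreover have "pverts G \<noteq> {}" if "connected (with_proj G)"
    using that by (simp add: connected_iff_rtrancl)
  ultimately show ?thesis
    unfolding connected_min_degree_3_def min_degree_def using assms pair_finite_verts by auto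
qed

lemma connected_min_degree_3_three_arc_graph:
  assumes "connected_min_degree_3 G"
  shows "connected_min_degree_3 (three_arc_graph G)"
proof -
  interpret pair_graph G using assms by (simp add: connected_min_degree_3_def)
  interpret X: pair_graph "three_arc_graph G"
    by (rule pair_graph_three_arc_graph) unfold_locales
  have "connected (with_proj G)" "\<And>u. u \<in> pverts G \<Longrightarrow> 3 \<le> card (nbrs u)"
    using assms by (auto simp: connected_min_degree_3_def nbrs_def)
  then show ?thesis
    using three_arc_graph_connected three_arc_graph_degree X.pair_graph_axioms
    by (simp add: connected_min_degree_3_def X.nbrs_def)
qed

lemma connected_min_degree_3_relabel:
  assumes "connected_min_degree_3 G" "inj f"
  shows "connected_min_degree_3 (relabel f G)"
proof -
  interpret pair_graph G using assms by (simp add: connected_min_degree_3_def)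
  interpret R: pair_graph "relabel f G"
    by (rule pair_graph_relabel[OF _ assms(2)]) unfold_locales
  have map: "(f a, f b) \<in> (parcs (relabel f G))\<^sup>*" if "(a, b) \<in> (parcs G)\<^sup>*" for a b
    using that
    by induction (force simp: relabel_def intro: rtrancl_into_rtrancl)+
  have "{v. (f u, v) \<in> parcs (relabel f G)} = f ` {v. (u, v) \<in> parcs G}" for u
    using assms(2) by (force simp: relabel_def inj_eq)
  then have "card {v. (f u, v) \<in> parcs (relabel f G)} = card {v. (u, v) \<in> parcs G}" for u
    using assms(2) by (simp add: card_image inj_on_subset)
  then show ?thesis
    using assms(1) map R.pair_graph_axioms
    unfolding connected_min_degree_3_def connected_iff_rtrancl R.connected_iff_rtrancl
    by (simp add: relabel_def)
qed

lemma hamiltonian_relabel: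
  assumes "hamiltonian G" "inj f"
  shows "hamiltonian (relabel f G)"
proof -
  obtain u p where p: "set p \<subseteq> parcs G" "pcas u p u" "distinct (map snd p)" "3 \<le> length p"
    "fst ` set p = pverts G"
    using assms(1) unfolding hamiltonian_iff_closed_walk by blast
  let ?q = "map (map_prod f f) p"
  have "pcas u p v \<Longrightarrow> pcas (f u) (map (map_prod f f) p) (f v)" for u v p
    by (induction p arbitrary: u) auto
  then have "pcas (f u) ?q (f u)" using p(2) by blast
  moreover have "set ?q \<subseteq> parcs (relabel f G)" using p(1) by (auto simp: relabel_def)
  moreover have "map snd ?q = map f (map snd p)" by simp
  then have "distinct (map snd ?q)" 
    using p(3) inj_on_subset[OF assms(2) subset_UNIV] by (simp only: distinct_map)
  moreover have "fst ` set ?q = pverts (relabel f G)"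
    unfolding relabel_def by (simp add: p(5)[symmetric] image_image)
  moreover have "3 \<le> length ?q" using p(4) by simp
  ultimately show ?thesis unfolding hamiltonian_iff_closed_walk by blast
qed

lemma iterated_three_arc_graph_hamiltonian:
  assumes "connected_min_degree_3 G"
  shows "connected_min_degree_3 (iter_three_arc_graph i G) \<and>
    hamiltonian (iter_three_arc_graph (Suc i) G)"
proof -
  have thick: "connected_min_degree_3 (iter_three_arc_graph j G)" for j
    by (induction j)
      (auto intro!: connected_min_degree_3_relabel connected_min_degree_3_three_arc_graph assms simp: inj_def)
  have "hamiltonian (three_arc_graph (iter_three_arc_graph i G))"
    using thick[of i] connected_min_degree_3_three_arc_graph[OF thick[of i]]
    by (intro pair_graph.hamiltonian_three_arc_graph_if_connected) (auto simp: connected_min_degree_3_def)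
  then show ?thesis using thick by (auto intro!: hamiltonian_relabel simp: inj_def)
qed

theorem theorem2:
  fixes G :: "'a pair_pre_digraph"
  assumes "pair_graph G"
  shows "(hamiltonian (three_arc_graph G) \<longleftrightarrow> connected (with_proj (three_arc_graph G))) \<and>
         (connected (with_proj G) \<and> 3 \<le> min_degree G \<longrightarrow>
            (\<forall>i\<ge>1. hamiltonian (iter_three_arc_graph i G)))"
proof (intro conjI iffI impI allI)
  interpret pair_graph G by fact
  interpret X: pair_graph "three_arc_graph G" using assms by (rule pair_graph_three_arc_graph)
  show "connected (with_proj (three_arc_graph G))" if "hamiltonian (three_arc_graph G)"
    using that by (rule X.connected_if_hamiltonian)
  show "hamiltonian (three_arc_graph G)" if "connected (with_proj (three_arc_graph G))"
    using that by (rule hamiltonian_three_arc_graph_if_connected)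
  fix i :: nat assume "connected (with_proj G) \<and> 3 \<le> min_degree G" "1 \<le> i"
  then show "hamiltonian (iter_three_arc_graph i G)"
    using iterated_three_arc_graph_hamiltonian[of G "i - 1"] connected_min_degree_3_iff[OF assms]
    by simp
qed

end
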